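(* For a typical compact set $A\in\mathcal{K}([0,1])$ the following holds: $\dim_H S^m(A)=0$ for every positive integer $m$, and $\dim_H\widetilde{P}(A)=0$ for every polynomial $P$ with real coefficients. That is, the set of all $A\in\mathcal{K}([0,1])$ for which this fails (for some $m$ or some $P$) is of first category in $(\mathcal{K}([0,1]),d_H)$.
   Context: $\mathcal{K}([0,1])$ denotes the set of all nonempty compact subsets of $[0,1]$ with the Hausdorff metric $d_H(E,F)=\inf\{\varepsilon>0: E\subset F^\varepsilon \text{ and } F\subset E^\varepsilon\}$, where $E^\varepsilon=\{x\in\mathbb{R}:\operatorname{dist}(x,E)<\varepsilon\}$. A subset of a metric space is nowhere dense if its closure has empty interior, and is of first category if it is a countable union of nowhere dense sets. A typical element of a metric space $X$ has a property if the set of elements of $X$ not having the property is of first category in $X$. For $A,B\subset\mathbb{R}$ and $\lambda\in\mathbb{R}$: $A+B=\{a+b:a\in A,b\in B\}$ and $\lambda A=\{\lambda a: a\in A\}$. For a positive integer $m$, $S^m(A)=\{\sum_{i=1}^m x_i: x_i\in A,\ 1\le i\le m\}$ and $T^m(A)=\{x_1 x_2\cdots x_m: x_i\in A,\ 1\le i\le m\}$; also $T^0(A)=\{1\}$. For a polynomial $P(x)=\sum_{k=0}^n a_kx^k$ with $a_k\in\mathbb{R}$, $\widetilde{P}(A)=\sum_{k=0}^n a_kT^k(A)$, the sum set of the sets $a_kT^k(A)$, $0\le k\le n$. $\dim_H$ denotes Hausdorff dimension. *)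

theory Defs
  imports "HOL-Analysis.Analysis" "HOL-Computational_Algebra.Polynomial"
begin

subsection \<open>Category\<close>

definition nowhere_dense_in :: "'a topology \<Rightarrow> 'a set \<Rightarrow> bool" where
  "nowhere_dense_in X S \<longleftrightarrow> S \<subseteq> topspace X \<and> X interior_of (X closure_of S) = {}"

definition first_category_in :: "'a topology \<Rightarrow> 'a set \<Rightarrow> bool" where
  "first_category_in X S \<longleftrightarrow>
    (\<exists>\<N>. countable \<N> \<and> (\<forall>N\<in>\<N>. nowhere_dense_in X N) \<and> S = \<Union>\<N>)"

definition typical_in :: "'a topology \<Rightarrow> ('a \<Rightarrow> bool) \<Rightarrow> bool" where
  "typical_in X P \<longleftrightarrow> first_category_in X {x \<in> topspace X. \<not> P x}"

subsection \<open>The space of nonempty compact subsets of the unit interval\<close>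

definition unit_compacts :: "real set set" where
  "unit_compacts = {A. compact A \<and> A \<noteq> {} \<and> A \<subseteq> {0..1}}"

definition thickening :: "real \<Rightarrow> 'a::metric_space set \<Rightarrow> 'a set" where
  "thickening \<epsilon> E = {x. infdist x E < \<epsilon>}"

definition hausdorff_radii :: "'a::metric_space set \<Rightarrow> 'a set \<Rightarrow> real set" where
  "hausdorff_radii E F = {\<epsilon>. \<epsilon> > 0 \<and> E \<subseteq> thickening \<epsilon> F \<and> F \<subseteq> thickening \<epsilon> E}"

text \<open>For nonempty bounded sets \<^term>\<open>hausdorff_radii E F\<close> is nonempty.  The value \<open>0\<close> in the
  other case never matters on the hyperspace; it is there because \<^locale>\<open>Metric_space\<close> wants a
  function that is nonnegative off the carrier too, and \<^term>\<open>Inf {} :: real\<close> is unspecified.\<close>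

definition hausdorff_dist :: "'a::metric_space set \<Rightarrow> 'a set \<Rightarrow> real" where
  "hausdorff_dist E F =
    (if hausdorff_radii E F = {} then 0 else Inf (hausdorff_radii E F))"

definition hyperspace :: "real set metric" where
  "hyperspace = metric (unit_compacts, hausdorff_dist)"

lemma hausdorff_radii_commute: "hausdorff_radii E F = hausdorff_radii F E"
  by (auto simp: hausdorff_radii_def)

lemma bdd_below_hausdorff_radii: "bdd_below (hausdorff_radii E F)"
  by (rule bdd_belowI[of _ 0]) (auto simp: hausdorff_radii_def)

lemma hausdorff_dist_nonneg: "hausdorff_dist E F \<ge> 0"
  by (auto simp: hausdorff_dist_def hausdorff_radii_def intro!: cInf_greatest)

lemma subset_thickening_add:
  assumes "E \<subseteq> thickening a F" "F \<subseteq> thickening b G" "F \<noteq> {}"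
  shows "E \<subseteq> thickening (a + b) G"
proof
  fix x assume "x \<in> E"
  then have "infdist x F < a"
    using assms by (auto simp: thickening_def)
  then obtain y where y: "y \<in> F" "dist x y < a"
    using \<open>F \<noteq> {}\<close> cInf_lessD[of "dist x ` F" a] by (auto simp: infdist_notempty)
  have "infdist y G < b"
    using assms y by (auto simp: thickening_def)
  moreover have "infdist x G \<le> infdist y G + dist x y"
    by (rule infdist_triangle)
  ultimately show "x \<in> thickening (a + b) G"
    using y by (simp add: thickening_def)
qed

lemma hausdorff_radii_add:
  assumes "a \<in> hausdorff_radii E F" "b \<in> hausdorff_radii F G" "F \<noteq> {}"
  shows "a + b \<in> hausdorff_radii E G"
  using assms subset_thickening_add[of E a F b G] subset_thickening_add[of G b F a E]
  by (auto simp: hausdorff_radii_def add.commute)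

lemma hausdorff_radii_unit_compacts:
  assumes "E \<in> unit_compacts" "F \<in> unit_compacts"
  shows "2 \<in> hausdorff_radii E F"
proof -
  have *: "A \<subseteq> thickening 2 B" if A: "A \<in> unit_compacts" and B: "B \<in> unit_compacts" for A B
  proof
    fix x assume "x \<in> A"
    obtain y where "y \<in> B" using B by (auto simp: unit_compacts_def)
    then have "infdist x B \<le> dist x y" by (rule infdist_le)
    also have "dist x y < 2"
      using A B \<open>x \<in> A\<close> \<open>y \<in> B\<close> by (force simp: unit_compacts_def dist_real_def)
    finally show "x \<in> thickening 2 B" by (simp add: thickening_def)
  qed
  show ?thesis
    using *[OF assms] *[OF assms(2,1)] by (simp add: hausdorff_radii_def)
qed

lemma hausdorff_dist_unit_compacts:
  assumes "E \<in> unit_compacts" "F \<in> unit_compacts"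
  shows "hausdorff_dist E F = Inf (hausdorff_radii E F)"
  using hausdorff_radii_unit_compacts[OF assms] by (auto simp: hausdorff_dist_def)

lemma hausdorff_dist_lessD:
  assumes "hausdorff_dist E F < e" "E \<in> unit_compacts" "F \<in> unit_compacts"
  obtains a where "a \<in> hausdorff_radii E F" "a < e"
proof -
  have "hausdorff_radii E F \<noteq> {}"
    using hausdorff_radii_unit_compacts assms by blast
  then show thesis
    using that cInf_lessD[of "hausdorff_radii E F" e] assms
    by (auto simp: hausdorff_dist_unit_compacts)
qed

lemma hausdorff_dist_eq_0_imp_subset:
  assumes "hausdorff_dist E F = 0" and E: "E \<in> unit_compacts" and F: "F \<in> unit_compacts"
  shows "E \<subseteq> F"
proof
  fix x assume x: "x \<in> E"
  have "infdist x F < e" if e: "e > 0" for e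
  proof -
    obtain a where "a \<in> hausdorff_radii E F" "a < e"
      by (rule hausdorff_dist_lessD[of E F e]) (use assms e in auto)
    with x have "infdist x F < a"
      by (auto simp: hausdorff_radii_def thickening_def)
    with \<open>a < e\<close> show ?thesis by simp
  qed
  from this[of "infdist x F"] have "infdist x F = 0"
    using infdist_nonneg[of x F] by linarith
  moreover have "closed F" "F \<noteq> {}"
    using F by (auto simp: unit_compacts_def compact_imp_closed)
  ultimately show "x \<in> F"
    using in_closed_iff_infdist_zero by blast
qed

lemma hausdorff_dist_commute: "hausdorff_dist E F = hausdorff_dist F E"
  by (simp add: hausdorff_dist_def hausdorff_radii_commute[of E F])

lemma Metric_space_hausdorff_dist: "Metric_space unit_compacts hausdorff_dist"
proof
  show "0 \<le> hausdorff_dist E F" for E F :: "real set"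
    by (rule hausdorff_dist_nonneg)
  show "hausdorff_dist E F = hausdorff_dist F E" for E F :: "real set"
    by (rule hausdorff_dist_commute)
next
  fix E F assume E: "E \<in> unit_compacts" and F: "F \<in> unit_compacts"
  have "hausdorff_dist E E \<le> e" if "e > 0" for e
  proof -
    have "e \<in> hausdorff_radii E E"
      using that by (auto simp: hausdorff_radii_def thickening_def)
    then show ?thesis
      unfolding hausdorff_dist_unit_compacts[OF E E]
      by (rule cInf_lower[OF _ bdd_below_hausdorff_radii])
  qed
  from this[of "hausdorff_dist E E / 2"] have "hausdorff_dist E E = 0"
    using hausdorff_dist_nonneg[of E E] by linarith
  moreover have "E = F" if "hausdorff_dist E F = 0"
    using hausdorff_dist_eq_0_imp_subset[OF that E F]
      hausdorff_dist_eq_0_imp_subset[OF _ F E] that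
    by (simp add: hausdorff_dist_commute[of F E])
  ultimately show "hausdorff_dist E F = 0 \<longleftrightarrow> E = F" by blast
next
  fix E F G
  assume E: "E \<in> unit_compacts" and F: "F \<in> unit_compacts" and G: "G \<in> unit_compacts"
  show "hausdorff_dist E G \<le> hausdorff_dist E F + hausdorff_dist F G"
  proof (rule field_le_epsilon)
    fix e :: real assume "e > 0"
    obtain a where a: "a \<in> hausdorff_radii E F" "a < hausdorff_dist E F + e / 2"
      by (rule hausdorff_dist_lessD[OF _ E F, of "hausdorff_dist E F + e / 2"])
        (use \<open>e > 0\<close> in auto)
    obtain b where b: "b \<in> hausdorff_radii F G" "b < hausdorff_dist F G + e / 2"
      by (rule hausdorff_dist_lessD[OF _ F G, of "hausdorff_dist F G + e / 2"])
        (use \<open>e > 0\<close> in auto)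
    have "F \<noteq> {}" using F by (simp add: unit_compacts_def)
    with a b have "a + b \<in> hausdorff_radii E G"
      by (intro hausdorff_radii_add)
    then have "hausdorff_dist E G \<le> a + b"
      unfolding hausdorff_dist_unit_compacts[OF E G]
      by (rule cInf_lower[OF _ bdd_below_hausdorff_radii])
    then show "hausdorff_dist E G \<le> hausdorff_dist E F + hausdorff_dist F G + e"
      using a b by simp
  qed
qed

lemma mspace_hyperspace [simp]: "mspace hyperspace = unit_compacts"
  and mdist_hyperspace [simp]: "mdist hyperspace = hausdorff_dist"
  by (simp_all add: hyperspace_def Metric_space.mspace_metric Metric_space.mdist_metric
      Metric_space_hausdorff_dist)

subsection \<open>Hausdorff dimension\<close>

text \<open>The case \<open>s = 0\<close> is separate because \<open>0 powr 0 = 0\<close>, whereas the \<open>0\<close>-dimensional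
  measure must count points.\<close>

definition diameter_power :: "real \<Rightarrow> 'a::metric_space set \<Rightarrow> ennreal" where
  "diameter_power s U =
    (if U = {} then 0 else if s = 0 then 1 else ennreal (diameter U powr s))"

text \<open>Boundedness is required explicitly, as \<^const>\<open>diameter\<close> is meaningless on unbounded sets.\<close>

definition hausdorff_premeasure :: "real \<Rightarrow> real \<Rightarrow> 'a::metric_space set \<Rightarrow> ennreal" where
  "hausdorff_premeasure s \<delta> E =
    (INF U \<in> {U :: nat \<Rightarrow> 'a set.
        (\<forall>i. bounded (U i) \<and> diameter (U i) \<le> \<delta>) \<and> E \<subseteq> (\<Union>i. U i)}.
      \<Sum>i. diameter_power s (U i))"

definition hausdorff_measure :: "real \<Rightarrow> 'a::metric_space set \<Rightarrow> ennreal" where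
  "hausdorff_measure s E = (SUP \<delta> \<in> {0<..}. hausdorff_premeasure s \<delta> E)"

definition hausdorff_dim :: "'a::metric_space set \<Rightarrow> ennreal" where
  "hausdorff_dim E = (INF s \<in> {s. 0 \<le> s \<and> hausdorff_measure s E = 0}. ennreal s)"

subsection \<open>Sums, products and polynomials of sets\<close>

definition sum_set :: "nat \<Rightarrow> real set \<Rightarrow> real set" where
  "sum_set m A = {\<Sum>i=1..m. x i | x. \<forall>i\<in>{1..m}. x i \<in> A}"

definition product_set :: "nat \<Rightarrow> real set \<Rightarrow> real set" where
  "product_set m A = {\<Prod>i=1..m. x i | x. \<forall>i\<in>{1..m}. x i \<in> A}"

text \<open>The sum is the one of sets, from \<^theory>\<open>HOL-Library.Set_Algebras\<close>.  Each power of the set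
  is formed independently, so this is larger than the image of \<open>A\<close> under \<open>P\<close>.\<close>

definition poly_set :: "real poly \<Rightarrow> real set \<Rightarrow> real set" where
  "poly_set P A = (\<Sum>k=0..degree P. coeff P k *o product_set k A)"

end

theory Submission
  imports Defs
begin

text \<open>For each \<open>n\<close>, the sets \<open>A\<close> covered by some number \<open>k\<close> of open balls of diameter
  \<open>r < 1 / (n + 1)\<close> with \<open>r * k ^ n \<le> 1\<close> form a dense open set: open because the balls also
  cover a neighbourhood of \<open>A\<close>, dense because it contains the finite sets.  A typical \<open>A\<close> has
  such covers for all \<open>n\<close>.  A cover of \<open>A\<close> by \<open>k\<close> sets of diameter at most \<open>r\<close> yields a cover
  of a set built from \<open>A\<close> by sums, products and scalings by \<open>k ^ M\<close> sets of diameter at most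
  \<open>C * r\<close>, with \<open>M\<close> and \<open>C\<close> independent of the cover.  Hence for \<open>s > 0\<close> the sum of the
  diameters to the power \<open>s\<close> is at most \<open>k ^ M * (C * r) powr s \<le> C powr s * r powr (s / 2)\<close>
  once \<open>n \<ge> 2 * M / s\<close>, which is arbitrarily small.\<close>

section \<open>Covers by finitely many sets of small diameter\<close>

text \<open>The union is exactly \<open>E\<close>, so members of the cover lie in \<open>E\<close>
  and estimates valid only on \<open>E\<close> apply to them. Pairwise distances are bounded instead
  of \<open>diameter\<close>, which is meaningless on unbounded sets.\<close>

definition coverable :: "'a::metric_space set \<Rightarrow> nat \<Rightarrow> real \<Rightarrow> bool" where
  "coverable E k r \<longleftrightarrow> (\<exists>\<U>. finite \<U> \<and> card \<U> \<le> k \<and> E = \<Union>\<U> \<and>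
     (\<forall>U\<in>\<U>. \<forall>x\<in>U. \<forall>y\<in>U. dist x y \<le> r))"

lemma coverable_singleton: "coverable {c} 1 0"
  unfolding coverable_def by (rule exI[of _ "{{c}}"]) auto

lemma coverable_subset:
  assumes "coverable E k r" "D \<subseteq> E"
  shows "coverable D k r"
proof -
  obtain \<U> where \<U>: "finite \<U>" "card \<U> \<le> k" "E = \<Union>\<U>"
    "\<And>U x y. U \<in> \<U> \<Longrightarrow> x \<in> U \<Longrightarrow> y \<in> U \<Longrightarrow> dist x y \<le> r"
    using assms(1) unfolding coverable_def by blast
  show ?thesis
    unfolding coverable_def
  proof (intro exI[of _ "(\<lambda>U. U \<inter> D) ` \<U>"] conjI)
    show "card ((\<lambda>U. U \<inter> D) ` \<U>) \<le> k"
      using card_image_le[OF \<U>(1)] \<U>(2) by (rule order_trans)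
  qed (use \<U> assms(2) in auto)
qed

text \<open>Images under \<open>f\<close> of the products \<open>U \<times> V\<close>, with one
  factor from each cover, form the new cover; the Lipschitz bound controls their diameters.\<close>

lemma coverable_image2:
  assumes D: "coverable D k r" and E: "coverable E l t" and "a \<ge> 0" "b \<ge> 0"
    and f: "\<And>x x' y y'. x \<in> D \<Longrightarrow> x' \<in> D \<Longrightarrow> y \<in> E \<Longrightarrow> y' \<in> E \<Longrightarrow>
      dist (f x y) (f x' y') \<le> a * dist x x' + b * dist y y'"
  shows "coverable {f x y | x y. x \<in> D \<and> y \<in> E} (k * l) (a * r + b * t)"
proof -
  obtain \<U> where \<U>: "finite \<U>" "card \<U> \<le> k" "D = \<Union>\<U>"
    "\<And>U x y. U \<in> \<U> \<Longrightarrow> x \<in> U \<Longrightarrow> y \<in> U \<Longrightarrow> dist x y \<le> r"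
    using D unfolding coverable_def by blast
  obtain \<V> where \<V>: "finite \<V>" "card \<V> \<le> l" "E = \<Union>\<V>"
    "\<And>U x y. U \<in> \<V> \<Longrightarrow> x \<in> U \<Longrightarrow> y \<in> U \<Longrightarrow> dist x y \<le> t"
    using E unfolding coverable_def by blast
  let ?W = "(\<lambda>(U, V). (\<lambda>(x, y). f x y) ` (U \<times> V)) ` (\<U> \<times> \<V>)"
  show ?thesis
    unfolding coverable_def
  proof (intro exI[of _ ?W] conjI ballI)
    show "finite ?W" using \<U>(1) \<V>(1) by simp
    have "card ?W \<le> card (\<U> \<times> \<V>)"
      using \<U>(1) \<V>(1) by (intro card_image_le) simp
    also have "\<dots> \<le> k * l"
      using \<U>(2) \<V>(2) by (simp add: card_cartesian_product mult_le_mono)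
    finally show "card ?W \<le> k * l" .
    show "{f x y | x y. x \<in> D \<and> y \<in> E} = \<Union>?W"
      unfolding \<U>(3) \<V>(3) by fastforce
  next
    fix W p q assume "W \<in> ?W" "p \<in> W" "q \<in> W"
    then obtain U V x y x' y' where *: "U \<in> \<U>" "V \<in> \<V>" "x \<in> U" "y \<in> V" "x' \<in> U" "y' \<in> V"
      and pq: "p = f x y" "q = f x' y'" by auto
    have "dist p q \<le> a * dist x x' + b * dist y y'"
      unfolding pq using * \<U>(3) \<V>(3) by (intro f) auto
    also have "\<dots> \<le> a * r + b * t"
      using * \<U>(4) \<V>(4) \<open>a \<ge> 0\<close> \<open>b \<ge> 0\<close> by (intro add_mono mult_left_mono) auto
    finally show "dist p q \<le> a * r + b * t" .
  qed
qed

section \<open>Polynomial control of covers under sums, products and scalings\<close>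

text \<open>\<open>M\<close> and \<open>C\<close> are fixed before \<open>k\<close> and
  \<open>r\<close>, so that one pair serves the covers of \<open>A\<close> at all scales.\<close>

definition poly_coverable :: "'a::metric_space set \<Rightarrow> 'b::metric_space set \<Rightarrow> bool" where
  "poly_coverable A E \<longleftrightarrow>
     (\<exists>M C. C \<ge> 0 \<and> (\<forall>k r. coverable A k r \<longrightarrow> coverable E (k ^ M) (C * r)))"

lemma poly_coverable_refl: "poly_coverable A A"
  unfolding poly_coverable_def by (rule exI[of _ 1], rule exI[of _ 1]) simp

lemma poly_coverable_singleton: "poly_coverable A {c}"
  unfolding poly_coverable_def
  \<comment> \<open>With \<open>M = 0\<close> and \<open>C = 0\<close>, a cover by
    \<open>k ^ 0 = 1\<close> set of diameter \<open>0\<close> is asked for.\<close>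
  by (rule exI[of _ 0], rule exI[of _ 0]) (use coverable_singleton[of c] in simp)

lemma poly_coverable_subset:
  assumes "poly_coverable A E" "D \<subseteq> E"
  shows "poly_coverable A D"
  using assms coverable_subset unfolding poly_coverable_def by meson

text \<open>The numbers of sets multiply, so the exponents add; the constants combine with the
  weights \<open>a\<close> and \<open>b\<close>.\<close>

lemma poly_coverable_image2:
  assumes D: "poly_coverable A D" and E: "poly_coverable A E" and ab: "a \<ge> 0" "b \<ge> 0"
    and f: "\<And>x x' y y'. x \<in> D \<Longrightarrow> x' \<in> D \<Longrightarrow> y \<in> E \<Longrightarrow> y' \<in> E \<Longrightarrow>
      dist (f x y) (f x' y') \<le> a * dist x x' + b * dist y y'"
  shows "poly_coverable A {f x y | x y. x \<in> D \<and> y \<in> E}"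
proof -
  obtain M C where 1: "C \<ge> 0" "\<And>k r. coverable A k r \<Longrightarrow> coverable D (k ^ M) (C * r)"
    using D unfolding poly_coverable_def by blast
  obtain N B where 2: "B \<ge> 0" "\<And>k r. coverable A k r \<Longrightarrow> coverable E (k ^ N) (B * r)"
    using E unfolding poly_coverable_def by blast
  have "coverable {f x y | x y. x \<in> D \<and> y \<in> E} (k ^ (M + N)) ((a * C + b * B) * r)"
    if "coverable A k r" for k r
    using coverable_image2[OF 1(2)[OF that] 2(2)[OF that] ab f]
    by (simp add: power_add algebra_simps)
  moreover have "a * C + b * B \<ge> 0" using ab 1 2 by simp
  ultimately show ?thesis unfolding poly_coverable_def by blast
qed

lemma poly_coverable_set_plus:
  fixes D E :: "real set"
  assumes "poly_coverable A D" "poly_coverable A E"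
  shows "poly_coverable A (D + E)"
proof -
  have "poly_coverable A {x + y | x y. x \<in> D \<and> y \<in> E}"
    by (rule poly_coverable_image2[OF assms, of 1 1]) (auto simp: dist_real_def)
  then show ?thesis
    by (rule poly_coverable_subset) (auto simp: set_plus_def)
qed

lemma poly_coverable_scale:
  fixes E :: "real set"
  assumes "poly_coverable A E"
  shows "poly_coverable A (c *o E)"
proof -
  have "poly_coverable A {x * y | x y. x \<in> {c} \<and> y \<in> E}"
    \<comment> \<open>The first variable is confined to \<open>{c}\<close>, so its Lipschitz weight
      can be \<open>0\<close>.\<close>
    by (rule poly_coverable_image2[OF poly_coverable_singleton assms, of 0 "\<bar>c\<bar>"])
      (auto simp: dist_real_def simp flip: right_diff_distrib abs_mult)
  then show ?thesis
    by (rule poly_coverable_subset) (auto simp: elt_set_times_def)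
qed

text \<open>On the unit interval, multiplication is 1-Lipschitz in each variable separately.\<close>

lemma poly_coverable_mult:
  fixes D E :: "real set"
  assumes "poly_coverable A D" "poly_coverable A E" "D \<subseteq> {0..1}" "E \<subseteq> {0..1}"
  shows "poly_coverable A {x * y | x y. x \<in> D \<and> y \<in> E}"
proof (rule poly_coverable_image2[OF assms(1,2), of 1 1])
  fix x x' y y' assume *: "x \<in> D" "x' \<in> D" "y \<in> E" "y' \<in> E"
  have "dist (x * y) (x' * y') = \<bar>(x - x') * y + x' * (y - y')\<bar>"
    by (simp add: dist_real_def algebra_simps)
  also have "\<dots> \<le> \<bar>x - x'\<bar> * \<bar>y\<bar> + \<bar>x'\<bar> * \<bar>y - y'\<bar>"
    by (metis abs_mult abs_triangle_ineq)
  also have "\<dots> \<le> \<bar>x - x'\<bar> * 1 + 1 * \<bar>y - y'\<bar>"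
    using * assms(3,4) by (intro add_mono mult_left_mono mult_right_mono) auto
  finally show "dist (x * y) (x' * y') \<le> 1 * dist x x' + 1 * dist y y'"
    by (simp add: dist_real_def)
qed auto

lemma poly_coverable_sum_set: "poly_coverable A (sum_set m A)"
proof (induction m)
  case 0
  show ?case
    by (rule poly_coverable_subset[OF poly_coverable_singleton[of A 0]]) (auto simp: sum_set_def)
next
  case (Suc m)
  have "sum_set (Suc m) A \<subseteq> sum_set m A + A"
  proof
    fix z assume "z \<in> sum_set (Suc m) A"
    then obtain x where x: "\<forall>i\<in>{1..Suc m}. x i \<in> A" and z: "z = (\<Sum>i=1..Suc m. x i)"
      by (auto simp: sum_set_def)
    have "(\<Sum>i=1..m. x i) \<in> sum_set m A" using x by (auto simp: sum_set_def)
    with x show "z \<in> sum_set m A + A" by (simp add: z set_plus_intro)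
  qed
  with poly_coverable_set_plus[OF Suc poly_coverable_refl] show ?case
    by (rule poly_coverable_subset)
qed

text \<open>Keeps the partial products in the range to which \<open>poly_coverable_mult\<close>
  applies.\<close>

lemma product_set_subset_unit:
  assumes "A \<subseteq> {0..1}"
  shows "product_set m A \<subseteq> {0..1}"
  using assms unfolding product_set_def by (auto simp: subset_iff intro!: prod_nonneg prod_le_1)

lemma poly_coverable_product_set:
  assumes "A \<subseteq> {0..1}"
  shows "poly_coverable A (product_set m A)"
proof (induction m)
  case 0
  show ?case
    by (rule poly_coverable_subset[OF poly_coverable_singleton[of A 1]])
      (auto simp: product_set_def)
next
  case (Suc m)
  have "product_set (Suc m) A \<subseteq> {x * y | x y. x \<in> product_set m A \<and> y \<in> A}"
  proof
    fix z assume "z \<in> product_set (Suc m) A"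
    then obtain x where x: "\<forall>i\<in>{1..Suc m}. x i \<in> A" and z: "z = (\<Prod>i=1..Suc m. x i)"
      by (auto simp: product_set_def)
    have "(\<Prod>i=1..m. x i) \<in> product_set m A" using x by (auto simp: product_set_def)
    moreover have "x (Suc m) \<in> A" "z = (\<Prod>i=1..m. x i) * x (Suc m)" using x z by auto
    ultimately show "z \<in> {x * y | x y. x \<in> product_set m A \<and> y \<in> A}" by blast
  qed
  with poly_coverable_mult[OF Suc poly_coverable_refl product_set_subset_unit[OF assms] assms]
  show ?case
    by (rule poly_coverable_subset)
qed

lemma poly_coverable_poly_set:
  assumes "A \<subseteq> {0..1}"
  shows "poly_coverable A (poly_set P A)"
proof -
  \<comment> \<open>The upper limit is freed from \<open>degree P\<close>, so that the induction on
    it leaves the coefficients fixed.\<close>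
  have "poly_coverable A (\<Sum>k=0..n. coeff P k *o product_set k A)" for n
    by (induction n)
      (auto intro: poly_coverable_set_plus poly_coverable_scale
        poly_coverable_product_set[OF assms])
  then show ?thesis by (simp add: poly_set_def)
qed

section \<open>From covers to Hausdorff dimension zero\<close>

lemma hausdorff_premeasure_le_coverable:
  assumes "coverable E k r" "0 < s" "0 \<le> r" "r \<le> \<delta>"
  shows "hausdorff_premeasure s \<delta> E \<le> ennreal (real k * r powr s)"
proof -
  obtain \<U> where \<U>: "finite \<U>" "card \<U> \<le> k" "E = \<Union>\<U>"
    "\<And>U x y. U \<in> \<U> \<Longrightarrow> x \<in> U \<Longrightarrow> y \<in> U \<Longrightarrow> dist x y \<le> r"
    using assms(1) unfolding coverable_def by blast
  obtain h where h: "bij_betw h {0..<card \<U>} \<U>"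
    using ex_bij_betw_nat_finite[OF \<U>(1)] by blast
  \<comment> \<open>The premeasure ranges over infinite sequences; the padding by \<open>{}\<close>
    contributes \<open>0\<close> to the sum.\<close>
  define W where "W i = (if i < card \<U> then h i else {})" for i
  have W_in: "W i \<in> \<U>" if "i < card \<U>" for i
    using that bij_betwE[OF h] by (simp add: W_def)
  have W_dist: "dist x y \<le> r" if "x \<in> W i" "y \<in> W i" for i x y
    using that \<U>(4) W_in by (cases "i < card \<U>") (auto simp: W_def)
  have bounded: "bounded (W i)" for i
    unfolding bounded_def using W_dist by blast
  \<comment> \<open>The padding sets have diameter \<open>0\<close>, which is where
    \<open>0 \<le> r\<close> enters.\<close>
  have diam: "diameter (W i) \<le> r" for i
    using W_dist assms(3) by (cases "W i = {}") (auto simp: diameter_def intro!: cSUP_least)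
  have power: "diameter_power s (W i) \<le> ennreal (r powr s)" for i
    using diam diameter_ge_0[OF bounded] assms(2)
    by (auto simp: diameter_power_def intro!: ennreal_leI powr_mono2)
  have "E \<subseteq> (\<Union>i. W i)"
  proof
    fix x assume "x \<in> E"
    then obtain U where "U \<in> \<U>" "x \<in> U" using \<U>(3) by blast
    moreover have "\<U> = h ` {0..<card \<U>}" using h by (simp add: bij_betw_def)
    ultimately obtain i where "i < card \<U>" "U = h i"
      by (metis atLeastLessThan_iff imageE)
    with \<open>x \<in> U\<close> show "x \<in> (\<Union>i. W i)" by (auto simp: W_def intro!: exI[of _ i])
  qed
  then have "hausdorff_premeasure s \<delta> E \<le> (\<Sum>i. diameter_power s (W i))"
    unfolding hausdorff_premeasure_def
    using bounded diam assms(4) by (intro INF_lower) (auto intro: order_trans)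
  also have "\<dots> = (\<Sum>i<card \<U>. diameter_power s (W i))"
    by (rule suminf_finite) (auto simp: W_def diameter_power_def)
  also have "\<dots> \<le> (\<Sum>i<card \<U>. ennreal (r powr s))"
    by (intro sum_mono power)
  also have "\<dots> = ennreal (real (card \<U>) * r powr s)"
    by (simp add: ennreal_mult ennreal_of_nat_eq_real_of_nat)
  also have "\<dots> \<le> ennreal (real k * r powr s)"
    using \<U>(2) by (intro ennreal_leI mult_right_mono) auto
  finally show ?thesis .
qed

text \<open>The count uses up half of the exponent \<open>s\<close>: from
  \<open>k ^ n \<le> 1 / r\<close> and \<open>M \<le> n * (s / 2)\<close> follows
  \<open>k ^ M \<le> r powr (- (s / 2))\<close>.\<close>

lemma power_mult_powr_le:
  fixes k n M :: nat and r s C :: real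
  assumes "k \<ge> 1" "0 < r" "r * real k ^ n \<le> 1" "real M \<le> real n * (s / 2)" "C \<ge> 0" "s > 0"
  shows "real (k ^ M) * (C * r) powr s \<le> C powr s * r powr (s / 2)"
proof -
  have "real (k ^ M) = real k powr real M"
    using assms(1) by (simp add: powr_realpow)
  also have "\<dots> \<le> real k powr (real n * (s / 2))"
    using assms by (intro powr_mono) auto
  also have "\<dots> = (real k ^ n) powr (s / 2)"
    using assms(1) by (simp add: powr_powr powr_realpow[symmetric])
  also have "\<dots> \<le> (1 / r) powr (s / 2)"
    using assms by (intro powr_mono2) (auto simp: field_simps)
  also have "\<dots> = r powr (- (s / 2))"
    using assms by (simp add: powr_divide powr_minus field_simps)
  finally have "real (k ^ M) * (C * r) powr s \<le> r powr (- (s / 2)) * (C * r) powr s"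
    by (rule mult_right_mono) simp
  also have "\<dots> = C powr s * (r powr (- (s / 2)) * r powr s)"
    using assms by (simp add: powr_mult)
  also have "r powr (- (s / 2)) * r powr s = r powr (s / 2)"
    by (simp flip: powr_add)
  finally show ?thesis .
qed

lemma hausdorff_dim_eq_0I:
  assumes A: "\<And>n. \<exists>k r. k \<ge> 1 \<and> 0 < r \<and> r < 1 / real (Suc n) \<and> r * real k ^ n \<le> 1 \<and> coverable A k r"
    and E: "poly_coverable A E"
  shows "hausdorff_dim E = 0"
proof -
  obtain M C where C: "C \<ge> 0" "\<And>k r. coverable A k r \<Longrightarrow> coverable E (k ^ M) (C * r)"
    using E unfolding poly_coverable_def by blast
  have premeasure: "hausdorff_premeasure s \<delta> E = 0" if s: "s > 0" and \<delta>: "\<delta> > 0" for s \<delta>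
  proof -
    \<comment> \<open>The bound of \<open>power_mult_powr_le\<close> with \<open>r\<close> replaced
      by its upper bound \<open>1 / (n + 1)\<close>, hence independent of the cover chosen for
      \<open>n\<close>.\<close>
    let ?b = "\<lambda>n. C powr s * (1 / real (Suc n)) powr (s / 2)"
    have inv: "(\<lambda>n. 1 / real (Suc n)) \<longlonglongrightarrow> 0"
      using LIMSEQ_inverse_real_of_nat by (simp add: inverse_eq_divide)
    have "?b \<longlonglongrightarrow> C powr s * 0 powr (s / 2)"
      using s by (intro tendsto_mult tendsto_const tendsto_powr' inv) auto
    then have lim: "(\<lambda>n. ennreal (?b n)) \<longlonglongrightarrow> 0"
      using s tendsto_ennrealI[of ?b 0] by simp
    have "(\<lambda>n. C * (1 / real (Suc n))) \<longlonglongrightarrow> C * 0"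
      by (intro tendsto_mult tendsto_const inv)
    \<comment> \<open>For large \<open>n\<close> the covers are fine enough for
      \<open>\<delta>\<close>, and, by the next condition, \<open>n\<close> is large enough compared
      with \<open>M\<close> and \<open>s\<close>.\<close>
    then have "\<forall>\<^sub>F n in sequentially. C * (1 / real (Suc n)) < \<delta>"
      using \<delta> by (intro order_tendstoD) auto
    moreover have "\<forall>\<^sub>F n in sequentially. 2 * real M / s \<le> real n"
      using filterlim_real_sequentially by (simp add: filterlim_at_top)
    ultimately have "\<forall>\<^sub>F n in sequentially. hausdorff_premeasure s \<delta> E \<le> ennreal (?b n)"
    proof eventually_elim
      case (elim n)
      obtain k r where kr: "k \<ge> 1" "0 < r" "r < 1 / real (Suc n)" "r * real k ^ n \<le> 1"
        "coverable A k r" using A by blast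
      have "C * r \<le> C * (1 / real (Suc n))"
        using C(1) kr(3) by (intro mult_left_mono) auto
      then have "hausdorff_premeasure s \<delta> E \<le> ennreal (real (k ^ M) * (C * r) powr s)"
        using elim C(1) kr s
        by (intro hausdorff_premeasure_le_coverable C(2)) auto
      also have "\<dots> \<le> ennreal (C powr s * r powr (s / 2))"
        using elim C(1) kr s by (intro ennreal_leI power_mult_powr_le[where n = n])
          (auto simp: field_simps)
      also have "\<dots> \<le> ennreal (?b n)"
        using kr s by (intro ennreal_leI mult_left_mono powr_mono2) auto
      finally show ?case .
    qed
    from tendsto_lowerbound[OF lim this] show ?thesis by simp
  qed
  \<comment> \<open>Only positive \<open>s\<close> are tested: at \<open>s = 0\<close> the measure
    counts points and may be infinite, but the infimum over positive \<open>s\<close> is already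
    \<open>0\<close>.\<close>
  have "hausdorff_dim E \<le> ennreal s" if "s > 0" for s
  proof -
    have "hausdorff_measure s E = 0"
      unfolding hausdorff_measure_def using premeasure[OF that]
      by (simp add: SUP_eq_iff flip: bot_ennreal)
    then show ?thesis
      unfolding hausdorff_dim_def using that by (intro INF_lower) auto
  qed
  then have "hausdorff_dim E \<le> 0 + ennreal s" if "s > 0" for s
    using that by simp
  then have "hausdorff_dim E \<le> 0"
    by (rule ennreal_le_epsilon)
  then show ?thesis by simp
qed

section \<open>Typical properties from dense open sets\<close>

lemma nowhere_dense_in_subset:
  assumes "nowhere_dense_in X T" "S \<subseteq> T"
  shows "nowhere_dense_in X S"
  using assms interior_of_mono[OF closure_of_mono[OF assms(2)]]
  unfolding nowhere_dense_in_def by blast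

lemma nowhere_dense_in_Diff_dense_open:
  assumes "openin X G" "X closure_of G = topspace X"
  shows "nowhere_dense_in X (topspace X - G)"
proof -
  have "X closure_of (topspace X - G) = topspace X - G"
    using assms(1) by (intro closure_of_closedin closedin_diff) auto
  then show ?thesis
    using assms(2) by (simp add: nowhere_dense_in_def interior_of_complement)
qed

lemma typical_inI:
  fixes G :: "nat \<Rightarrow> 'a set"
  assumes "\<And>n. openin X (G n)" "\<And>n. X closure_of G n = topspace X"
    and P: "\<And>x. (\<And>n. x \<in> G n) \<Longrightarrow> P x"
  shows "typical_in X P"
  unfolding typical_in_def first_category_in_def
proof (intro exI conjI ballI)
  \<comment> \<open>First category asks for equality with a union, so each complement of
    \<open>G n\<close> is cut down to the exceptional set \<open>?B\<close>.\<close>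
  let ?B = "{x \<in> topspace X. \<not> P x}"
  show "countable (range (\<lambda>n. ?B \<inter> (topspace X - G n)))" by simp
  show "nowhere_dense_in X N" if "N \<in> range (\<lambda>n. ?B \<inter> (topspace X - G n))" for N
  proof -
    from that obtain n where "N = ?B \<inter> (topspace X - G n)" by (elim rangeE)
    then show ?thesis
      using nowhere_dense_in_subset[OF nowhere_dense_in_Diff_dense_open[OF assms(1,2)[of n]]]
      by simp
  qed
  show "?B = \<Union>(range (\<lambda>n. ?B \<inter> (topspace X - G n)))"
    using P by auto
qed

section \<open>The dense open sets in the hyperspace\<close>

text \<open>For \<open>n > 0\<close>, at most \<open>r powr (- 1 / n)\<close> balls are used at one
  scale \<open>r\<close>: a one-scale form of lower box dimension at most \<open>1 / n\<close>. The
  centres may lie outside \<open>A\<close>, so the same \<open>F\<close> can serve nearby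
  sets.\<close>

definition well_covered :: "nat \<Rightarrow> real set set" where
  "well_covered n = {A \<in> unit_compacts. \<exists>F r. finite F \<and> F \<noteq> {} \<and> 0 < r \<and>
     r < 1 / real (Suc n) \<and> r * real (card F) ^ n \<le> 1 \<and> A \<subseteq> (\<Union>x\<in>F. ball x (r / 2))}"

lemma well_covered_coverable:
  assumes "A \<in> well_covered n"
  shows "\<exists>k r. k \<ge> 1 \<and> 0 < r \<and> r < 1 / real (Suc n) \<and> r * real k ^ n \<le> 1 \<and> coverable A k r"
proof -
  obtain F r where F: "finite F" "F \<noteq> {}" "0 < r" "r < 1 / real (Suc n)"
    "r * real (card F) ^ n \<le> 1" "A \<subseteq> (\<Union>x\<in>F. ball x (r / 2))"
    using assms unfolding well_covered_def by blast
  have "dist y z \<le> r" if "y \<in> ball x (r / 2)" "z \<in> ball x (r / 2)" for x y z :: real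
    using that dist_triangle_half_r[of x y r z] by simp
  then have "coverable (\<Union>x\<in>F. ball x (r / 2)) (card F) r"
    unfolding coverable_def using F(1)
    by (intro exI[of _ "(\<lambda>x. ball x (r / 2)) ` F"]) (auto simp: card_image_le)
  then have "coverable A (card F) r"
    using F(6) by (rule coverable_subset)
  moreover have "card F \<ge> 1" using F by (simp add: Suc_le_eq card_gt_0_iff)
  ultimately show ?thesis using F by blast
qed

interpretation hyper: Metric_space unit_compacts "hausdorff_dist :: real set \<Rightarrow> _"
  by (rule Metric_space_hausdorff_dist)

lemma openin_well_covered: "openin hyper.mtopology (well_covered n)"
  unfolding hyper.openin_mtopology
proof (intro conjI allI impI)
  show "well_covered n \<subseteq> unit_compacts" by (auto simp: well_covered_def)
  fix A assume "A \<in> well_covered n"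
  then obtain F r where A: "A \<in> unit_compacts" and F: "finite F" "F \<noteq> {}" "0 < r"
    "r < 1 / real (Suc n)" "r * real (card F) ^ n \<le> 1" "A \<subseteq> (\<Union>x\<in>F. ball x (r / 2))"
    unfolding well_covered_def by blast
  have "compact A" "A \<noteq> {}" using A by (auto simp: unit_compacts_def)
  \<comment> \<open>Compactness leaves a uniform margin \<open>e\<close> around \<open>A\<close>
    inside the open cover, so \<open>F\<close> and \<open>r\<close> also work for every
    \<open>B\<close> within distance \<open>e\<close>.\<close>
  then obtain e where e: "e > 0" "(\<Union>x\<in>A. ball x e) \<subseteq> (\<Union>x\<in>F. ball x (r / 2))"
    using compact_subset_open_imp_ball_epsilon_subset[OF _ _ F(6)] by blast
  have "hyper.mball A e \<subseteq> well_covered n"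
  proof
    fix B assume "B \<in> hyper.mball A e"
    then have B: "B \<in> unit_compacts" "hausdorff_dist A B < e" by auto
    obtain a where a: "a \<in> hausdorff_radii A B" "a < e"
      by (rule hausdorff_dist_lessD[OF B(2) A B(1)])
    have "B \<subseteq> (\<Union>x\<in>A. ball x e)"
    proof
      fix y assume "y \<in> B"
      then have "infdist y A < e"
        using a by (auto simp: hausdorff_radii_def thickening_def)
      then obtain x where "x \<in> A" "dist y x < e"
        using \<open>A \<noteq> {}\<close> cInf_lessD[of "dist y ` A" e] by (auto simp: infdist_notempty)
      then show "y \<in> (\<Union>x\<in>A. ball x e)" by (auto simp: dist_commute)
    qed
    then have "B \<subseteq> (\<Union>x\<in>F. ball x (r / 2))"
      using e(2) by (rule order_trans)
    with B(1) F(1-5) show "B \<in> well_covered n"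
      unfolding well_covered_def by (intro CollectI conjI exI[of _ F] exI[of _ r])
  qed
  with e(1) show "\<exists>r>0. hyper.mball A r \<subseteq> well_covered n" by blast
qed

lemma finite_in_well_covered:
  assumes "finite F" "F \<in> unit_compacts"
  shows "F \<in> well_covered n"
proof -
  \<comment> \<open>The factor \<open>2\<close> makes \<open>c\<close> strictly smaller than
    \<open>1 / (n + 1)\<close>; dividing by the power of \<open>card F\<close> gives
    \<open>r * card F ^ n = c\<close>. The set \<open>F\<close> serves as its own set of
    centres.\<close>
  define c where "c = 1 / (2 * real (Suc n))"
  define r where "r = c / real (card F) ^ n"
  have c: "0 < c" "c < 1 / real (Suc n)" "c \<le> 1"
    by (auto simp: c_def divide_simps)
  have "F \<noteq> {}" using assms(2) by (simp add: unit_compacts_def)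
  then have "card F \<ge> 1" using assms(1) by (simp add: Suc_le_eq card_gt_0_iff)
  then have pow: "real (card F) ^ n \<ge> 1" by (simp add: one_le_power)
  then have "0 < real (card F) ^ n" by linarith
  then have "0 < r" "r * real (card F) ^ n \<le> 1"
    using c(1,3) by (auto simp: r_def)
  moreover have "r \<le> c"
    using mult_left_mono[OF pow, of c] c(1) \<open>0 < real (card F) ^ n\<close>
    by (simp add: r_def pos_divide_le_eq)
  then have "r < 1 / real (Suc n)"
    using c(2) by linarith
  moreover have "F \<subseteq> (\<Union>x\<in>F. ball x (r / 2))"
    using \<open>0 < r\<close> by auto
  ultimately show ?thesis
    unfolding well_covered_def using assms \<open>F \<noteq> {}\<close>
    by (intro CollectI conjI exI[of _ F] exI[of _ r])
qed

lemma well_covered_dense: "hyper.mtopology closure_of well_covered n = unit_compacts"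
proof -
  have "\<exists>B\<in>well_covered n. B \<in> hyper.mball A e" if A: "A \<in> unit_compacts" and e: "e > 0" for A e
  proof -
    have "compact A" "A \<noteq> {}" using A by (auto simp: unit_compacts_def)
    \<comment> \<open>Centres taken in \<open>A\<close> give a finite subset of \<open>A\<close>,
      hence an element of the hyperspace; radius \<open>e / 2\<close> leaves room for the strict
      inequality in \<open>mball\<close>.\<close>
    have "A \<subseteq> (\<Union>x\<in>A. ball x (e / 2))" using e by auto
    then obtain F where F: "F \<subseteq> A" "finite F" "A \<subseteq> (\<Union>x\<in>F. ball x (e / 2))"
      by (rule compactE_image[OF \<open>compact A\<close> open_ball])
    with A \<open>A \<noteq> {}\<close> have F': "F \<in> unit_compacts"
      by (auto simp: unit_compacts_def finite_imp_compact)
    have "A \<subseteq> thickening (e / 2) F"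
    proof
      fix x assume "x \<in> A"
      then obtain y where "y \<in> F" "dist x y < e / 2" using F(3) by (auto simp: dist_commute)
      with infdist_le[of y F x] show "x \<in> thickening (e / 2) F" by (simp add: thickening_def)
    qed
    moreover have "F \<subseteq> thickening (e / 2) A"
      using F(1) e by (auto simp: thickening_def subset_iff)
    ultimately have "e / 2 \<in> hausdorff_radii A F"
      using e by (simp add: hausdorff_radii_def)
    then have "hausdorff_dist A F \<le> e / 2"
      unfolding hausdorff_dist_unit_compacts[OF A F']
      by (rule cInf_lower[OF _ bdd_below_hausdorff_radii])
    with A F' e have "F \<in> hyper.mball A e" by simp
    with finite_in_well_covered[OF F(2) F'] show ?thesis by blast
  qed
  then show ?thesis by (auto simp: hyper.metric_closure_of)
qed

theorem theorem1p5:
  shows "typical_in (mtopology_of hyperspace)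
    (\<lambda>A. (\<forall>m::nat. m > 0 \<longrightarrow> hausdorff_dim (sum_set m A) = 0) \<and>
         (\<forall>P::real poly. hausdorff_dim (poly_set P A) = 0))"
proof (rule typical_inI[where G = well_covered])
  \<comment> \<open>The sets \<open>well_covered n\<close> do not depend on \<open>m\<close> or
    \<open>P\<close>, so one countable family handles the uncountably many polynomials.\<close>
  fix A assume A: "\<And>n. A \<in> well_covered n"
  then have "A \<subseteq> {0..1}"
    unfolding well_covered_def unit_compacts_def by blast
  with A show "(\<forall>m::nat. m > 0 \<longrightarrow> hausdorff_dim (sum_set m A) = 0) \<and>
      (\<forall>P::real poly. hausdorff_dim (poly_set P A) = 0)"
    using hausdorff_dim_eq_0I[OF well_covered_coverable] poly_coverable_sum_set
      poly_coverable_poly_set by blast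
qed (simp_all add: mtopology_of_def openin_well_covered well_covered_dense)

end
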